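(* Let $q$ be a prime power, let $k\ge 2$ and $2(k-1)<n\le q$. Then the number of distinct Reed--Solomon codes of dimension $k$ and length $n$ over $\mathbb{F}_q$ is $$v(q,n):=\frac{(q-2)!}{(q-n)!}.$$
   Context: For $\underline{\alpha}=(\alpha_1,\ldots,\alpha_n)\in\mathbb{F}_q^n$ with pairwise distinct entries, the Reed--Solomon code of dimension $k$ and length $n$ with evaluation vector $\underline{\alpha}$ is $\mathsf{RS}_{n,k}(\underline{\alpha})=\{(f(\alpha_1),\ldots,f(\alpha_n)) : f\in\mathbb{F}_q[x],\ \deg f<k\}\subseteq\mathbb{F}_q^n$. Codes are counted as distinct subspaces of $\mathbb{F}_q^n$. *)

theory Defs
  imports
    "Jordan_Normal_Form.Matrix"
    "HOL-Computational_Algebra.Polynomial"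
begin

definition evaluation_vectors :: "nat \<Rightarrow> 'a vec set" where
  "evaluation_vectors n = {\<alpha> \<in> carrier_vec n. inj_on (\<lambda>i. \<alpha> $ i) {..<n}}"

(* The disjunct f = 0 implements the convention deg 0 = -\<infinity>; it only matters for k = 0. *)
definition reed_solomon_code :: "nat \<Rightarrow> nat \<Rightarrow> 'a::field vec \<Rightarrow> 'a vec set" where
  "reed_solomon_code n k \<alpha> =
     {vec n (\<lambda>i. poly f (\<alpha> $ i)) | f. f = 0 \<or> degree f < k}"

definition reed_solomon_codes :: "nat \<Rightarrow> nat \<Rightarrow> 'a::field vec set set" where
  "reed_solomon_codes n k = reed_solomon_code n k ` evaluation_vectors n"

(* The subtractions are on nat, so this is the intended quotient only for 2 \<le> q and n \<le> q. *)
definition rs_count :: "nat \<Rightarrow> nat \<Rightarrow> rat" where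
  "rs_count q n = fact (q - 2) / fact (q - n)"

end

theory Submission
  imports Defs
begin

text \<open>
  The codes are counted as the fibres of \<open>\<alpha> \<mapsto> reed_solomon_code n k \<alpha>\<close> on the
  \<open>q! / (q - n)!\<close> evaluation vectors: every fibre is an orbit of the affine group
  \<open>x \<mapsto> a x + b\<close>, \<open>a \<noteq> 0\<close>, which acts freely and has \<open>(q - 1) q\<close> elements.

  An affine change of the evaluation points only substitutes a linear polynomial into the
  polynomials of degree less than \<open>k\<close>, so it does not change the code
  (\<open>reed_solomon_code_affine_image\<close>).  For the converse, suppose that \<open>\<alpha>\<close> and
  \<open>\<beta>\<close> give the same code.  The words \<open>\<beta>, \<beta>\<^sup>2, \<dots>\<close> of powers with exponent below \<open>k\<close> lie in
  that code, so they are evaluations at \<open>\<alpha>\<close> of polynomials of degree less than \<open>k\<close>; let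
  \<open>g\<close> be the polynomial for \<open>\<beta>\<close> itself and \<open>d\<close> its degree.  If \<open>d \<ge> 2\<close>, then
  there is a first exponent \<open>j < k\<close> for which the degree \<open>d j\<close> of \<open>g ^ j\<close> exceeds
  \<open>k - 1\<close>, and this degree is at most \<open>2 (k - 1) < n\<close> because one factor \<open>g\<close> fewer
  gave a degree of at most \<open>k - 1\<close>.  But a polynomial of degree less than \<open>n\<close> is
  determined by its values at the \<open>n\<close> points, and these values are also those of a
  polynomial of degree less than \<open>k\<close>: a contradiction.  Hence \<open>d \<le> 1\<close>
  (\<open>degree_le_1_of_power_evaluations\<close>), and \<open>d \<noteq> 0\<close> because the entries of
  \<open>\<beta>\<close> are distinct, so \<open>\<beta>\<close> is an affine image of \<open>\<alpha>\<close>.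
\<close>

section \<open>Affine changes of the evaluation points\<close>

text \<open>
  The pair \<open>(a, b)\<close> stands for the map \<open>x \<mapsto> a x + b\<close>; keeping it as one argument lets
  an orbit be the image of the product set \<open>(UNIV - {0}) \<times> UNIV\<close>.
\<close>
definition affine_image :: "'a \<times> 'a \<Rightarrow> 'a::field vec \<Rightarrow> 'a vec" where
  "affine_image ab \<alpha> = map_vec (\<lambda>x. fst ab * x + snd ab) \<alpha>"

lemma affine_image_carrier [simp]:
  "affine_image ab \<alpha> \<in> carrier_vec n \<longleftrightarrow> \<alpha> \<in> carrier_vec n"
  by (simp add: affine_image_def)

lemma affine_image_evaluation_vectors:
  assumes "\<alpha> \<in> evaluation_vectors n" and "fst ab \<noteq> 0"
  shows "affine_image ab \<alpha> \<in> evaluation_vectors n"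
proof -
  have carrier: "\<alpha> \<in> carrier_vec n" and inj: "inj_on (\<lambda>i. \<alpha> $ i) {..<n}"
    using assms(1) unfolding evaluation_vectors_def by blast+
  have "inj_on (\<lambda>i. affine_image ab \<alpha> $ i) {..<n}"
  proof (rule inj_onI)
    fix i j assume ij: "i \<in> {..<n}" "j \<in> {..<n}"
      and "affine_image ab \<alpha> $ i = affine_image ab \<alpha> $ j"
    then have "\<alpha> $ i = \<alpha> $ j" using carrier assms(2) by (simp add: affine_image_def)
    then show "i = j" using inj ij by (simp add: inj_onD)
  qed
  then show ?thesis using carrier by (simp add: evaluation_vectors_def)
qed

text \<open>
  Evaluating \<open>f\<close> at \<open>a x + b\<close> is evaluating \<open>f \<circ> (a X + b)\<close> at \<open>x\<close>, and the
  substitution does not raise the degree.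
\<close>
lemma reed_solomon_code_affine_image_subset:
  assumes "\<alpha> \<in> carrier_vec n"
  shows "reed_solomon_code n k (affine_image ab \<alpha>) \<subseteq> reed_solomon_code n k \<alpha>"
proof
  fix w assume "w \<in> reed_solomon_code n k (affine_image ab \<alpha>)"
  then obtain f where f: "f = 0 \<or> degree f < k"
    and w: "w = vec n (\<lambda>i. poly f (affine_image ab \<alpha> $ i))"
    by (auto simp: reed_solomon_code_def)
  define h where "h = pcompose f [:snd ab, fst ab:]"
  have "degree h \<le> degree f * degree [:snd ab, fst ab:]"
    unfolding h_def by (rule degree_pcompose_le)
  also have "\<dots> \<le> degree f" by simp
  finally have "h = 0 \<or> degree h < k" using f by (auto simp: h_def)
  moreover have "w = vec n (\<lambda>i. poly h (\<alpha> $ i))"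
    using assms by (auto simp: w h_def affine_image_def poly_pcompose algebra_simps)
  ultimately show "w \<in> reed_solomon_code n k \<alpha>"
    by (auto simp: reed_solomon_code_def)
qed

lemma affine_image_inverse:
  assumes "fst ab \<noteq> 0"
  shows "affine_image (inverse (fst ab), - snd ab / fst ab) (affine_image ab \<alpha>) = \<alpha>"
proof (rule eq_vecI)
  have "inverse (fst ab) * (fst ab * x + snd ab) - snd ab / fst ab = x" for x
    using assms by (simp add: distrib_left divide_inverse mult.assoc[symmetric])
  then show "affine_image (inverse (fst ab), - snd ab / fst ab) (affine_image ab \<alpha>) $ i = \<alpha> $ i"
    if "i < dim_vec \<alpha>" for i
    using that by (simp add: affine_image_def)
qed (simp add: affine_image_def)

text \<open>The reverse inclusion is the previous one for the inverse affine map.\<close>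
lemma reed_solomon_code_affine_image:
  assumes "\<alpha> \<in> carrier_vec n" and "fst ab \<noteq> 0"
  shows "reed_solomon_code n k (affine_image ab \<alpha>) = reed_solomon_code n k \<alpha>"
proof (rule equalityI)
  show "reed_solomon_code n k (affine_image ab \<alpha>) \<subseteq> reed_solomon_code n k \<alpha>"
    by (rule reed_solomon_code_affine_image_subset[OF assms(1)])
  have "reed_solomon_code n k
      (affine_image (inverse (fst ab), - snd ab / fst ab) (affine_image ab \<alpha>))
    \<subseteq> reed_solomon_code n k (affine_image ab \<alpha>)"
    by (rule reed_solomon_code_affine_image_subset) (use assms in simp)
  then show "reed_solomon_code n k \<alpha> \<subseteq> reed_solomon_code n k (affine_image ab \<alpha>)"
    by (simp only: affine_image_inverse[OF assms(2)])
qed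

section \<open>Evaluation vectors with the same code\<close>

text \<open>
  The degrees of the powers \<open>g ^ j\<close> grow in steps of \<open>degree g\<close>.  While they stay below
  the number of points, \<open>g ^ j\<close> is the only polynomial of such a degree with its values,
  so a \<open>g\<close> of degree at least 2 would leave the polynomials of degree less than \<open>k\<close>
  at some exponent below \<open>k\<close>.
\<close>
lemma degree_le_1_of_power_evaluations:
  fixes g :: "'a::field poly"
  assumes "degree g < k" and "2 * (k - 1) < card A"
    and powers: "\<And>j. j < k \<Longrightarrow> \<exists>h. degree h < k \<and> (\<forall>x\<in>A. poly h x = poly g x ^ j)"
  shows "degree g \<le> 1"
proof (rule ccontr)
  assume "\<not> degree g \<le> 1"
  then have d: "2 \<le> degree g" by simp
  \<comment> \<open>the first exponent for which \<open>g ^ j\<close> has degree greater than \<open>k - 1\<close>\<close>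
  define j where "j = (k - 1) div degree g + 1"
  have le: "degree g * ((k - 1) div degree g) \<le> k - 1" by simp
  have lower: "k - 1 < degree g * j"
    unfolding j_def using d dividend_less_times_div[of "degree g" "k - 1"] by simp
  have upper: "degree g * j \<le> 2 * (k - 1)"
  proof -
    have "degree g * j = degree g * ((k - 1) div degree g) + degree g" by (simp add: j_def)
    also have "\<dots> \<le> (k - 1) + (k - 1)" by (intro add_mono le) (use assms(1) in simp)
    finally show ?thesis by simp
  qed
  have "j < k"
  proof -
    have "2 * ((k - 1) div degree g) \<le> degree g * ((k - 1) div degree g)"
      using d by (rule mult_le_mono1)
    also note le
    finally have "2 * (j - 1) \<le> k - 1" by (simp add: j_def)
    with assms(1) d show ?thesis by linarith
  qed
  have "degree (g ^ j) = degree g * j"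
  proof -
    have "g \<noteq> 0" using d by auto
    then show ?thesis by (simp add: degree_power_eq)
  qed
  with lower upper have deg: "k \<le> degree (g ^ j)" "degree (g ^ j) < card A"
    using assms(2) by linarith+
  obtain h where h: "degree h < k" "\<forall>x\<in>A. poly h x = poly g x ^ j"
    using powers[OF \<open>j < k\<close>] by blast
  have "h = g ^ j"
    by (rule poly_eqI_degree[of A]) (use h deg in auto)
  with h deg show False by simp
qed

text \<open>
  The evaluations of the monomials \<open>X\<^sup>j\<close>, \<open>j < k\<close>, at \<open>\<beta>\<close> are codewords, hence
  evaluations of polynomials of degree less than \<open>k\<close> at \<open>\<alpha>\<close>.  This is what the bound
  on the degree needs.
\<close>
lemma eq_affine_image_if_reed_solomon_code_eq:
  fixes \<alpha> \<beta> :: "'a::field vec"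
  assumes \<alpha>: "\<alpha> \<in> evaluation_vectors n" and \<beta>: "\<beta> \<in> evaluation_vectors n"
    and k: "2 \<le> k" and n: "2 * (k - 1) < n"
    and eq: "reed_solomon_code n k \<beta> = reed_solomon_code n k \<alpha>"
  shows "\<exists>a b. a \<noteq> 0 \<and> \<beta> = affine_image (a, b) \<alpha>"
proof -
  have dims: "dim_vec \<alpha> = n" "dim_vec \<beta> = n"
    and inj: "inj_on (\<lambda>i. \<alpha> $ i) {..<n}" "inj_on (\<lambda>i. \<beta> $ i) {..<n}"
    using \<alpha> \<beta> by (auto simp: evaluation_vectors_def)
  have powers: "\<exists>h. degree h < k \<and> (\<forall>i<n. poly h (\<alpha> $ i) = (\<beta> $ i) ^ j)" if "j < k" for j
  proof -
    have "vec n (\<lambda>i. poly (monom 1 j) (\<beta> $ i)) \<in> reed_solomon_code n k \<beta>"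
      using that by (auto simp: reed_solomon_code_def degree_monom_eq)
    then obtain h where "h = 0 \<or> degree h < k"
      and h: "vec n (\<lambda>i. poly (monom 1 j) (\<beta> $ i)) = vec n (\<lambda>i. poly h (\<alpha> $ i))"
      unfolding eq by (auto simp: reed_solomon_code_def)
    then have "degree h < k" using k by auto
    moreover have "poly h (\<alpha> $ i) = (\<beta> $ i) ^ j" if "i < n" for i
      using arg_cong[OF h, of "\<lambda>v. v $ i"] that by (simp add: poly_monom)
    ultimately show ?thesis by blast
  qed
  from powers[of 1] k obtain g
    where g: "degree g < k" "\<And>i. i < n \<Longrightarrow> poly g (\<alpha> $ i) = \<beta> $ i"
    by auto
  have "degree g \<le> 1"
  proof (rule degree_le_1_of_power_evaluations[of g k "(\<lambda>i. \<alpha> $ i) ` {..<n}"])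
    show "2 * (k - 1) < card ((\<lambda>i. \<alpha> $ i) ` {..<n})"
      using inj n by (simp add: card_image)
    show "\<exists>h. degree h < k \<and> (\<forall>x\<in>(\<lambda>i. \<alpha> $ i) ` {..<n}. poly h x = poly g x ^ j)"
      if "j < k" for j
      using powers[OF that] g(2) by auto
  qed (fact g(1))
  then obtain a b where ab: "g = [:b, a:]"
    by (metis One_nat_def degree_eq_zeroE degree1_coeffs le_Suc_eq le_zero_eq pCons_0_0)
  have \<beta>_eq: "\<beta> = affine_image (a, b) \<alpha>"
    using g(2) dims by (auto simp: ab affine_image_def algebra_simps)
  have "a \<noteq> 0"
  proof
    assume "a = 0"
    then have "\<beta> $ 0 = \<beta> $ 1" using g(2)[of 0] g(2)[of 1] k n by (simp add: ab)
    moreover have "1 < n" using k n by linarith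
    ultimately show False using inj_onD[OF inj(2), of 0 1] by simp
  qed
  with \<beta>_eq show ?thesis by blast
qed

section \<open>Counting\<close>

text \<open>The action is free because an affine map is determined by its values at two points.\<close>
lemma inj_affine_image:
  assumes "\<alpha> \<in> evaluation_vectors n" and "2 \<le> n"
  shows "inj (\<lambda>ab. affine_image ab \<alpha>)"
proof (rule injI)
  fix ab cd assume eq: "affine_image ab \<alpha> = affine_image cd \<alpha>"
  obtain a b c d where [simp]: "ab = (a, b)" "cd = (c, d)" by (cases ab, cases cd)
  have dim: "dim_vec \<alpha> = n" and inj: "inj_on (\<lambda>i. \<alpha> $ i) {..<n}"
    using assms by (auto simp: evaluation_vectors_def)
  have ne: "\<alpha> $ 0 \<noteq> \<alpha> $ 1" using inj_onD[OF inj, of 0 1] assms(2) by auto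
  have at: "a * \<alpha> $ i + b = c * \<alpha> $ i + d" if "i < n" for i
    using arg_cong[OF eq, of "\<lambda>v. v $ i"] that dim by (simp add: affine_image_def)
  have "(a - c) * (\<alpha> $ 0 - \<alpha> $ 1)
      = ((a * \<alpha> $ 0 + b) - (c * \<alpha> $ 0 + d)) - ((a * \<alpha> $ 1 + b) - (c * \<alpha> $ 1 + d))"
    by (simp add: algebra_simps)
  also have "\<dots> = 0" using at[of 0] at[of 1] assms(2) by simp
  finally have "(a - c) * (\<alpha> $ 0 - \<alpha> $ 1) = 0" .
  with ne have "a = c" by simp
  with at[of 0] assms(2) show "ab = cd" by simp
qed

lemma card_reed_solomon_code_fibre:
  fixes \<alpha> :: "'a::{field,finite} vec"
  assumes \<alpha>: "\<alpha> \<in> evaluation_vectors n"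
    and k: "2 \<le> k" and n: "2 * (k - 1) < n"
  shows "card {\<beta> \<in> evaluation_vectors n. reed_solomon_code n k \<beta> = reed_solomon_code n k \<alpha>}
    = (card (UNIV :: 'a set) - 1) * card (UNIV :: 'a set)"
proof -
  have "{\<beta> \<in> evaluation_vectors n. reed_solomon_code n k \<beta> = reed_solomon_code n k \<alpha>}
      = (\<lambda>ab. affine_image ab \<alpha>) ` ((UNIV - {0}) \<times> UNIV)" (is "?F = ?O")
  proof
    show "?F \<subseteq> ?O"
      using eq_affine_image_if_reed_solomon_code_eq[OF \<alpha> _ k n] by fastforce
    have "\<alpha> \<in> carrier_vec n" using \<alpha> by (simp add: evaluation_vectors_def)
    then show "?O \<subseteq> ?F"
      using \<alpha> by (auto simp: affine_image_evaluation_vectors reed_solomon_code_affine_image)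
  qed
  moreover have "inj_on (\<lambda>ab. affine_image ab \<alpha>) ((UNIV - {0}) \<times> UNIV)"
    by (rule inj_on_subset[OF inj_affine_image[OF \<alpha>]]) (use k n in auto)
  ultimately show ?thesis by (simp add: card_image card_cartesian_product)
qed

lemma bij_betw_evaluation_vectors_distinct_lists:
  "bij_betw list_of_vec (evaluation_vectors n :: 'a vec set) {xs. length xs = n \<and> distinct xs}"
proof (rule bij_betw_byWitness[of _ vec_of_list])
  show "list_of_vec ` evaluation_vectors n \<subseteq> {xs. length xs = n \<and> distinct xs}"
    by (auto simp: evaluation_vectors_def distinct_conv_nth inj_on_def list_of_vec_index)
  show "vec_of_list ` {xs :: 'a list. length xs = n \<and> distinct xs} \<subseteq> evaluation_vectors n"
  proof (rule image_subsetI)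
    fix xs :: "'a list" assume "xs \<in> {xs. length xs = n \<and> distinct xs}"
    then have xs: "length xs = n" "distinct xs" by auto
    then have "inj_on (\<lambda>i. vec_of_list xs $ i) {..<n}"
      unfolding vec_of_list_index by (intro inj_on_nth) auto
    moreover have "vec_of_list xs \<in> carrier_vec n" using xs(1) by (intro carrier_vecI) simp
    ultimately show "vec_of_list xs \<in> evaluation_vectors n"
      unfolding evaluation_vectors_def by blast
  qed
qed (auto simp: vec_list list_vec)

lemma card_evaluation_vectors:
  assumes "n \<le> card (UNIV :: 'a::finite set)"
  shows "finite (evaluation_vectors n :: 'a vec set)"
    and "card (evaluation_vectors n :: 'a vec set) * fact (card (UNIV :: 'a set) - n)
      = fact (card (UNIV :: 'a set))"
proof -
  note bij = bij_betw_evaluation_vectors_distinct_lists[of n, where 'a = 'a]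
  have "finite {xs :: 'a list. length xs = n \<and> distinct xs}"
    by (rule finite_subset[OF _ finite_lists_length_eq[of UNIV n]]) auto
  with bij show "finite (evaluation_vectors n :: 'a vec set)"
    using bij_betw_finite by blast
  have "card (evaluation_vectors n :: 'a vec set)
      = \<Prod>{card (UNIV :: 'a set) - n + 1 .. card (UNIV :: 'a set)}"
    using bij_betw_same_card[OF bij] assms
      card_lists_distinct_length_eq[of "UNIV :: 'a set" n]
    by simp
  also have "\<dots> = fact (card (UNIV :: 'a set)) div fact (card (UNIV :: 'a set) - n)"
    by (simp add: fact_div_fact)
  finally show "card (evaluation_vectors n :: 'a vec set) * fact (card (UNIV :: 'a set) - n)
      = fact (card (UNIV :: 'a set))"
    by (simp add: fact_dvd)
qed

theorem corollary3p3:
  fixes q n k :: nat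
  assumes "card (UNIV :: 'a::{field,finite} set) = q"
    and "k \<ge> 2"
    and "2 * (k - 1) < n"
    and "n \<le> q"
  shows "of_nat (card (reed_solomon_codes n k :: 'a vec set set)) = rs_count q n"
proof -
  let ?E = "evaluation_vectors n :: 'a vec set" and ?RS = "reed_solomon_code n k"
  let ?N = "card (reed_solomon_codes n k :: 'a vec set set)"
  have nq: "n \<le> card (UNIV :: 'a set)" and q: "2 \<le> q" using assms by auto
  note E = card_evaluation_vectors[OF nq]
  \<comment> \<open>split the evaluation vectors into the fibres over the codes\<close>
  have "card ?E = (\<Sum>C\<in>?RS ` ?E. card {\<beta> \<in> ?E. ?RS \<beta> = C})"
    using sum.image_gen[OF E(1), of "\<lambda>_. 1::nat" ?RS] by simp
  also have "\<dots> = (\<Sum>C\<in>?RS ` ?E. (q - 1) * q)"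
    using card_reed_solomon_code_fibre[OF _ assms(2,3), where 'a = 'a]
    by (intro sum.cong) (auto simp: assms(1))
  finally have "?N * ((q - 1) * q) * fact (q - n) = fact q"
    using E(2) by (simp add: assms(1) reed_solomon_codes_def)
  moreover have "fact q = fact (q - 2) * ((q - 1) * q)"
  proof -
    obtain m where "q = Suc (Suc m)" using q by (metis Suc_le_D numeral_2_eq_2 Suc_le_mono)
    then show ?thesis by (simp add: algebra_simps)
  qed
  ultimately have "?N * fact (q - n) = fact (q - 2)"
    using q by (auto simp: mult_ac)
  then have "of_nat ?N * fact (q - n) = (fact (q - 2) :: rat)"
    by (metis of_nat_fact of_nat_mult)
  then show ?thesis by (simp add: rs_count_def field_simps)
qed

end
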